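(* Let $G=P_n$ for $n\ge 2$ or $G=C_n$ for $n\ge 3$. For any positive integer $k$, $\gamma_L^k(G)=\dim_k(G)+1$ if one of the following holds: (i) $G\in\{P_n,C_n\}$ and $n\equiv 1\pmod{3k+2}$; (ii) $G=P_n$ and $n\equiv k+2\pmod{3k+2}$; (iii) $G=C_n$, $n\ge 3k+4$, and $n\equiv k+2\pmod{3k+2}$; and $\gamma_L^k(G)=\dim_k(G)$ otherwise.
   Context: $P_n$ and $C_n$ are the path and the cycle on $n$ vertices. $d(x,y)$ is the length of a shortest path between $x$ and $y$ in $G$. For a positive integer $k$, let $d_k(x,y)=\min\{d(x,y),k+1\}$. A set $D\subseteq V(G)$ is a distance-$k$ dominating set of $G$ if for each $u\in V(G)\setminus D$ there is $w\in D$ with $d(u,w)\le k$. A set $S\subseteq V(G)$ is a distance-$k$ resolving set of $G$ if for any distinct $x,y\in V(G)$ there is $z\in S$ with $d_k(x,z)\ne d_k(y,z)$; the distance-$k$ dimension $\dim_k(G)$ is the minimum cardinality of a distance-$k$ resolving set. A distance-$k$ locating-dominating set of $G$ is a set $S\subseteq V(G)$ that is both a distance-$k$ dominating set and a distance-$k$ resolving set of $G$; the distance-$k$ location-domination number $\gamma_L^k(G)$ is the minimum cardinality of such a set. *)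

theory Defs
  imports "Graph_Theory.Graph_Theory" "HOL-Library.Extended_Nat" "HOL-Number_Theory.Cong"
begin

text \<open>
  Simple graphs are the finite, symmetric, loop-free digraphs without parallel arcs
  (\<^locale>\<open>pair_graph\<close>): an edge is represented by its two opposite arcs.
\<close>

definition path_graph :: "nat \<Rightarrow> nat pair_pre_digraph" where
  "path_graph n =
    \<lparr> pverts = {..<n},
      parcs = {(i, j). i < n \<and> j < n \<and> (j = Suc i \<or> i = Suc j)} \<rparr>"

definition cycle_graph :: "nat \<Rightarrow> nat pair_pre_digraph" where
  "cycle_graph n =
    \<lparr> pverts = {..<n},
      parcs = {(i, j). i < n \<and> j < n \<and> (j = Suc i mod n \<or> i = Suc j mod n)} \<rparr>"

lemma pair_graph_path_graph: "pair_graph (path_graph n)"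
proof -
  have "finite (parcs (path_graph n))"
    by (rule finite_subset[of _ "{..<n} \<times> {..<n}"]) (auto simp: path_graph_def)
  then show ?thesis
    by unfold_locales (auto simp: path_graph_def symmetric_def sym_def)
qed

lemma pair_graph_cycle_graph:
  assumes "n \<ge> 2"
  shows "pair_graph (cycle_graph n)"
proof -
  have "finite (parcs (cycle_graph n))"
    by (rule finite_subset[of _ "{..<n} \<times> {..<n}"]) (auto simp: cycle_graph_def)
  moreover have "Suc i mod n \<noteq> i" if "i < n" for i
    using assms that by (cases "Suc i = n") auto
  ultimately show ?thesis
    by unfold_locales (fastforce simp: cycle_graph_def symmetric_def sym_def)+
qed

text \<open>
  A path is given by its list of arcs, so its length is the number of edges; the trivial path
  from a vertex to itself is the empty list. The infimum over the empty set is \<open>\<infinity>\<close>, so vertices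
  in different components are at infinite distance.
\<close>

definition graph_dist :: "'a pair_pre_digraph \<Rightarrow> 'a \<Rightarrow> 'a \<Rightarrow> enat" where
  "graph_dist G x y = (INF p \<in> {p. pre_digraph.apath (with_proj G) x p y}. enat (length p))"

text \<open>This is the distance of the library for unit arc costs.\<close>

lemma graph_dist_eq_mu:
  assumes "pair_fin_digraph G"
  shows "ereal_of_enat (graph_dist G x y) = wf_digraph.\<mu> (with_proj G) (\<lambda>_. 1) x y"
proof -
  interpret pair_fin_digraph G by (rule assms)
  have cost: "awalk_cost (\<lambda>_. 1) p = real (length p)" for p :: "('a \<times> 'a) list"
    by (induction p) auto
  show ?thesis
  proof (cases "x \<rightarrow>\<^sup>*\<^bsub>with_proj G\<^esub> y")
    case True
    have "\<exists>p. apath x p y \<and> \<mu> (\<lambda>_. 1) x y = ereal (awalk_cost (\<lambda>_. 1) p)"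
      by (rule no_neg_cyc_reach_imp_path[OF True]) (auto simp: cost)
    then obtain p where p: "apath x p y" "\<mu> (\<lambda>_. 1) x y = ereal (real (length p))"
      by (auto simp: cost)
    have "length p \<le> length q" if "apath x q y" for q
      using min_cost_le_walk_cost[OF awalkI_apath[OF that], of "\<lambda>_. 1"] p(2)
      by (simp add: cost)
    then have "graph_dist G x y = enat (length p)"
      unfolding graph_dist_def using p(1)
      by (intro antisym INF_lower2[of p] INF_greatest) auto
    then show ?thesis using p(2) by simp
  next
    case False
    then have "{p. apath x p y} = {}"
      by (auto simp: reachable_apath)
    then show ?thesis
      using shortest_path_inf[OF False] by (simp add: graph_dist_def top_enat_def)
  qed
qed

definition trunc_dist :: "'a pair_pre_digraph \<Rightarrow> nat \<Rightarrow> 'a \<Rightarrow> 'a \<Rightarrow> enat" where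
  "trunc_dist G k x y = min (graph_dist G x y) (enat (k + 1))"

definition distance_dominating :: "'a pair_pre_digraph \<Rightarrow> nat \<Rightarrow> 'a set \<Rightarrow> bool" where
  "distance_dominating G k D \<longleftrightarrow>
    D \<subseteq> pverts G \<and> (\<forall>u \<in> pverts G - D. \<exists>w \<in> D. graph_dist G u w \<le> enat k)"

definition distance_resolving :: "'a pair_pre_digraph \<Rightarrow> nat \<Rightarrow> 'a set \<Rightarrow> bool" where
  "distance_resolving G k S \<longleftrightarrow>
    S \<subseteq> pverts G \<and>
    (\<forall>x \<in> pverts G. \<forall>y \<in> pverts G. x \<noteq> y \<longrightarrow>
      (\<exists>z \<in> S. trunc_dist G k x z \<noteq> trunc_dist G k y z))"

definition distance_locating_dominating :: "'a pair_pre_digraph \<Rightarrow> nat \<Rightarrow> 'a set \<Rightarrow> bool" where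
  "distance_locating_dominating G k S \<longleftrightarrow>
    distance_dominating G k S \<and> distance_resolving G k S"

text \<open>
  For finite \<open>G\<close> the whole vertex set qualifies in both definitions below, so \<open>LEAST\<close> is a
  genuine minimum. Finiteness of \<open>S\<close> only matters for infinite \<open>G\<close>, where \<open>card\<close> would be 0
  on infinite sets.
\<close>

definition distance_dimension :: "'a pair_pre_digraph \<Rightarrow> nat \<Rightarrow> nat" where
  "distance_dimension G k =
    (LEAST m. \<exists>S. finite S \<and> distance_resolving G k S \<and> card S = m)"

definition distance_location_domination_number :: "'a pair_pre_digraph \<Rightarrow> nat \<Rightarrow> nat" where
  "distance_location_domination_number G k =
    (LEAST m. \<exists>S. finite S \<and> distance_locating_dominating G k S \<and> card S = m)"

end

(* Say that s sees v if d(v, s) <= k. In a resolving set S at most one vertex is unseen, and by a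
   counting argument (each s pays for k + 1 vertices, and at most half of S for k more) the m
   elements of S together see at most B(m) = m (k + 1) + floor(m / 2) k vertices. Hence n <= B(m)
   if S is locating-dominating and n <= B(m) + 1 if S is merely resolving. Sets with
   gaps alternating between k + 1 and 2k + 1 attain both bounds (on short cycles, both numbers are
   2), so the two minima differ, by one, exactly when n = B(m) + 1 for some m. Since
   B(2q) = q (3k + 2) and B(2q + 1) = q (3k + 2) + k + 1, these are the listed residues. *)
theory Submission
  imports Defs
begin

text \<open>What decides resolvability is whether a member \<open>s\<close> of \<open>S\<close> has
  another member within distance \<open>k + 1\<close>. Distinct vertices left unresolved, one of
  them seen from \<open>s\<close>, have \<open>s\<close> as midpoint; a second member that close
  sees one of the two as well, so it would be a midpoint too. Without such a member the two vertices
  adjacent to \<open>s\<close> stay unresolved, unless \<open>s\<close> is an end of a path. Hence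
  the gap \<open>k + 1\<close> in the optimal sets, and the forced overlaps that sharpen the
  counting. The obstacle is the cycle: members at offset \<open>g\<close> share their midpoints when
  \<open>2 * g\<close> is divisible by \<open>n\<close>. With \<open>g\<close> at most
  \<open>k + 1\<close> this is excluded for \<open>n\<close> at least \<open>2 * k + 3\<close>;
  shorter cycles are treated apart. There the counting bound is also too weak: it allows one element
  when \<open>n\<close> is at most \<open>k + 2\<close>, but the reflection in that element defeats
  it. This is why (iii) leaves out \<open>n = k + 2\<close>, the only length of that residue below
  \<open>3 * k + 4\<close>.\<close>

text \<open>Replaces truncated distances by the threshold tests \<open>d(x, y) \<le> d\<close> for
  \<open>d \<le> k\<close>, so that no distance ever has to be computed.\<close>

lemma min_enat_eq_iff:
  "min a (enat (k + 1)) = min b (enat (k + 1)) \<longleftrightarrow> (\<forall>d\<le>k. a \<le> enat d \<longleftrightarrow> b \<le> enat d)"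
proof (induction a b rule: linorder_wlog)
  case (le a b)
  show ?case
  proof
    assume "min a (enat (k + 1)) = min b (enat (k + 1))"
    then show "\<forall>d\<le>k. a \<le> enat d \<longleftrightarrow> b \<le> enat d"
      using le by (cases a; cases b) (auto simp: min_def split: if_splits)
  next
    assume *: "\<forall>d\<le>k. a \<le> enat d \<longleftrightarrow> b \<le> enat d"
    show "min a (enat (k + 1)) = min b (enat (k + 1))"
    proof (cases "a \<le> enat k")
      case True
      then obtain d where d: "a = enat d" "d \<le> k" by (cases a) auto
      with * have "b \<le> a" by auto
      with le show ?thesis by simp
    next
      case False
      then have "enat (k + 1) \<le> a" by (cases a) auto
      with le have "enat (k + 1) \<le> b" by (rule order.trans[rotated])
      with \<open>enat (k + 1) \<le> a\<close> show ?thesis by (simp add: min_def)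
    qed
  qed
next
  case (sym a b)
  then show ?case by (metis (no_types, lifting))
qed

section \<open>Distances in paths and cycles\<close>

text \<open>The library distance is an infimum over all walks, so the explicit walks built below
  need not be shown free of repeated vertices.\<close>

lemma graph_dist_le_iff:
  assumes "pair_fin_digraph G"
  shows "graph_dist G x y \<le> enat d \<longleftrightarrow>
    (\<exists>p. pre_digraph.awalk (with_proj G) x p y \<and> length p \<le> d)"
proof -
  interpret pair_fin_digraph G by (rule assms)
  have cost: "awalk_cost (\<lambda>_. 1) p = real (length p)" for p :: "('a \<times> 'a) list"
    by (induction p) auto
  show ?thesis
  proof
    assume le: "graph_dist G x y \<le> enat d"
    let ?A = "{p. apath x p y}"
    have "?A \<noteq> {}"
    proof
      assume "?A = {}"
      with le show False unfolding graph_dist_def by (simp only:) (simp add: top_enat_def)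
    qed
    then have "(INF p \<in> ?A. enat (length p)) \<in> (\<lambda>p. enat (length p)) ` ?A"
      by (auto simp: Inf_enat_def intro: LeastI)
    then obtain p where "apath x p y" "graph_dist G x y = enat (length p)"
      by (auto simp: graph_dist_def)
    with le show "\<exists>p. awalk x p y \<and> length p \<le> d"
      by (auto intro: awalkI_apath)
  next
    assume "\<exists>p. awalk x p y \<and> length p \<le> d"
    then obtain p where p: "awalk x p y" "length p \<le> d" by blast
    have "ereal_of_enat (graph_dist G x y) \<le> ereal (real (length p))"
      using min_cost_le_walk_cost[OF p(1), of "\<lambda>_. 1"] graph_dist_eq_mu[OF assms]
      by (simp add: cost)
    then show "graph_dist G x y \<le> enat d"
      using p(2) by (cases "graph_dist G x y") auto
  qed
qed

lemma path_graph_simps: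
  "pverts (path_graph n) = {..<n}"
  "(i, j) \<in> parcs (path_graph n) \<longleftrightarrow> i < n \<and> j < n \<and> (j = Suc i \<or> i = Suc j)"
  by (simp_all add: path_graph_def)

lemma cycle_graph_simps:
  "pverts (cycle_graph n) = {..<n}"
  "(i, j) \<in> parcs (cycle_graph n) \<longleftrightarrow> i < n \<and> j < n \<and> (j = Suc i mod n \<or> i = Suc j mod n)"
  by (simp_all add: cycle_graph_def)

text \<open>Each arc moves the position by one. Congruence modulo 0 is equality; this form matches
  the one for the cycle.\<close>

lemma graph_dist_path_graph:
  assumes "x < n" "y < n"
  shows "graph_dist (path_graph n) x y \<le> enat d \<longleftrightarrow>
    (\<exists>i. \<bar>i\<bar> \<le> int d \<and> [int x = int y + i] (mod 0))"
proof -
  interpret pair_graph "path_graph n" by (rule pair_graph_path_graph)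
  have lower: "\<bar>int x - int y\<bar> \<le> int (length p)" if "awalk x p y" for x p
    using that
  proof (induction p arbitrary: x)
    case (Cons e p)
    then have "e \<in> parcs (path_graph n)" "fst e = x" "awalk (snd e) p y"
      by (auto simp: awalk_simps)
    with Cons.IH[of "snd e"] show ?case by (auto simp: path_graph_def)
  qed (simp add: awalk_simps)
  have down: "\<exists>p. awalk (y + i) p y \<and> length p = i" if "y + i < n" for i
    using that
  proof (induction i)
    case 0
    then show ?case by (intro exI[of _ "[]"]) (auto simp: awalk_simps path_graph_simps)
  next
    case (Suc i)
    then obtain p where "awalk (y + i) p y" "length p = i" by auto
    with Suc.prems show ?case
      by (intro exI[of _ "(y + Suc i, y + i) # p"]) (auto simp: awalk_simps path_graph_simps)
  qed
  have up: "\<exists>p. awalk x p y \<and> length p = i" if "x + i = y" for x i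
    using that
  proof (induction i arbitrary: x)
    case 0
    then show ?case using assms(2)
      by (intro exI[of _ "[]"]) (auto simp: awalk_simps path_graph_simps)
  next
    case (Suc i)
    then obtain p where "awalk (Suc x) p y" "length p = i" by fastforce
    with Suc.prems assms(2) show ?case
      by (intro exI[of _ "(x, Suc x) # p"]) (auto simp: awalk_simps path_graph_simps)
  qed
  have "(\<exists>p. awalk x p y \<and> length p \<le> d) \<longleftrightarrow> \<bar>int x - int y\<bar> \<le> int d"
  proof
    assume "\<exists>p. awalk x p y \<and> length p \<le> d"
    then show "\<bar>int x - int y\<bar> \<le> int d" using lower by fastforce
  next
    assume le: "\<bar>int x - int y\<bar> \<le> int d"
    show "\<exists>p. awalk x p y \<and> length p \<le> d"
    proof (cases "y \<le> x")
      case True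
      then show ?thesis using down[of "x - y"] assms(1) le by fastforce
    next
      case False
      then show ?thesis using up[of x "y - x"] le by fastforce
    qed
  qed
  moreover have "(\<exists>i. \<bar>i\<bar> \<le> int d \<and> [int x = int y + i] (mod 0)) \<longleftrightarrow> \<bar>int x - int y\<bar> \<le> int d"
    by (auto intro: exI[of _ "int x - int y"])
  ultimately show ?thesis
    by (simp only: graph_dist_le_iff[OF pair_fin_digraph_axioms])
qed

text \<open>An arc changes the offset by one in either direction. The offset need not be minimal:
  \<open>up\<close> and \<open>down\<close> yield walks that may wind around the cycle.\<close>

lemma graph_dist_cycle_graph:
  assumes "n \<ge> 2" "x < n" "y < n"
  shows "graph_dist (cycle_graph n) x y \<le> enat d \<longleftrightarrow>
    (\<exists>i. \<bar>i\<bar> \<le> int d \<and> [int x = int y + i] (mod int n))"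
proof -
  interpret pair_graph "cycle_graph n" by (rule pair_graph_cycle_graph[OF assms(1)])
  have lower: "\<exists>i. \<bar>i\<bar> \<le> int (length p) \<and> [int x = int y + i] (mod int n)" if "awalk x p y" for x p
    using that
  proof (induction p arbitrary: x)
    case Nil
    then show ?case by (auto simp: awalk_simps)
  next
    case (Cons e p)
    define z where "z = snd e"
    from Cons.prems have "e \<in> parcs (cycle_graph n)" "fst e = x" "awalk z p y"
      by (auto simp: awalk_simps z_def)
    then have z: "awalk z p y" "z = Suc x mod n \<or> x = Suc z mod n"
      by (auto simp: cycle_graph_def z_def)
    from Cons.IH[OF z(1)] obtain i where i: "\<bar>i\<bar> \<le> int (length p)" "[int z = int y + i] (mod int n)"
      by blast
    from z(2) show ?case
    proof
      assume "z = Suc x mod n"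
      then have "[int z = int x + 1] (mod int n)" by (simp add: cong_def zmod_int ac_simps)
      with i(2) have "[int x + 1 = int y + i] (mod int n)" by (metis cong_sym cong_trans)
      then have "[int x = int y + (i - 1)] (mod int n)"
        by (simp add: cong_iff_dvd_diff algebra_simps)
      with i(1) show ?thesis by (intro exI[of _ "i - 1"]) auto
    next
      assume "x = Suc z mod n"
      then have "[int x = int z + 1] (mod int n)" by (simp add: cong_def zmod_int ac_simps)
      then have "[int x = (int y + i) + 1] (mod int n)"
        using cong_trans cong_add[OF i(2) cong_refl] by blast
      then have "[int x = int y + (i + 1)] (mod int n)" by (simp add: add.assoc)
      with i(1) show ?thesis by (intro exI[of _ "i + 1"]) auto
    qed
  qed
  have down: "\<exists>p. awalk ((y + i) mod n) p y \<and> length p = i" for i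
  proof (induction i)
    case 0
    then show ?case using assms by (intro exI[of _ "[]"]) (auto simp: awalk_simps cycle_graph_simps)
  next
    case (Suc i)
    then obtain p where "awalk ((y + i) mod n) p y" "length p = i" by auto
    with assms show ?case
      by (intro exI[of _ "((y + Suc i) mod n, (y + i) mod n) # p"])
        (auto simp: awalk_simps cycle_graph_simps mod_Suc_eq)
  qed
  have up: "\<exists>p. awalk x p ((x + i) mod n) \<and> length p = i" if "x < n" for x i
    using that
  proof (induction i arbitrary: x)
    case 0
    then show ?case by (intro exI[of _ "[]"]) (auto simp: awalk_simps cycle_graph_simps)
  next
    case (Suc i)
    have "((Suc x mod n) + i) mod n = (x + Suc i) mod n" by (simp add: mod_add_left_eq)
    then obtain p where "awalk (Suc x mod n) p ((x + Suc i) mod n)" "length p = i"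
      using Suc.IH[of "Suc x mod n"] assms by auto
    with Suc.prems assms show ?case
      by (intro exI[of _ "(x, Suc x mod n) # p"]) (auto simp: awalk_simps cycle_graph_simps)
  qed
  have "(\<exists>p. awalk x p y \<and> length p \<le> d) \<longleftrightarrow>
    (\<exists>i. \<bar>i\<bar> \<le> int d \<and> [int x = int y + i] (mod int n))"
  proof
    assume "\<exists>p. awalk x p y \<and> length p \<le> d"
    then obtain p where p: "awalk x p y" "length p \<le> d" by blast
    from lower[OF p(1)] obtain i where "\<bar>i\<bar> \<le> int (length p)" "[int x = int y + i] (mod int n)"
      by blast
    with p(2) show "\<exists>i. \<bar>i\<bar> \<le> int d \<and> [int x = int y + i] (mod int n)"
      by (intro exI[of _ i]) auto
  next
    assume "\<exists>i. \<bar>i\<bar> \<le> int d \<and> [int x = int y + i] (mod int n)"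
    then obtain i where i: "\<bar>i\<bar> \<le> int d" "[int x = int y + i] (mod int n)" by blast
    define j where "j = nat \<bar>i\<bar>"
    have "j \<le> d" using i(1) by (simp add: j_def)
    show "\<exists>p. awalk x p y \<and> length p \<le> d"
    proof (cases "i \<ge> 0")
      case True
      then have "[int x = int (y + j)] (mod int n)" using i(2) by (simp add: j_def)
      then have "[x = y + j] (mod n)" by (rule cong_int_iff[THEN iffD1])
      then have "x = (y + j) mod n" using assms(2) by (simp add: cong_def)
      then show ?thesis using down[of j] \<open>j \<le> d\<close> by auto
    next
      case False
      then have "[int x + int j = int y] (mod int n)"
        using i(2) by (simp add: j_def cong_iff_dvd_diff algebra_simps)
      then have "[int (x + j) = int y] (mod int n)" by simp
      then have "[x + j = y] (mod n)" by (rule cong_int_iff[THEN iffD1])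
      then have "y = (x + j) mod n" using assms(3) by (simp add: cong_def)
      then show ?thesis using up[OF assms(2), of j] \<open>j \<le> d\<close> by auto
    qed
  qed
  then show ?thesis
    by (simp only: graph_dist_le_iff[OF pair_fin_digraph_axioms])
qed

section \<open>The periodic sets and the counting bound\<close>

text \<open>Two members per window of length \<open>3 * k + 2\<close>: offset \<open>k\<close> sees
  offsets \<open>0\<close> to \<open>2 * k\<close>, and offset \<open>2 * k + 1\<close> sees
  \<open>k + 1\<close> to \<open>3 * k + 1\<close>. Together they see exactly the window, and they
  are \<open>k + 1\<close> apart.\<close>

definition blocks :: "nat \<Rightarrow> nat \<Rightarrow> nat set" where
  "blocks k q = (\<Union>j<q. {j * (3 * k + 2) + k, j * (3 * k + 2) + 2 * k + 1})"

lemma blocks_Suc: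
  "blocks k (Suc q) = blocks k q \<union> {q * (3 * k + 2) + k, q * (3 * k + 2) + 2 * k + 1}"
  by (auto simp: blocks_def lessThan_Suc)

lemma blocks_first: "q \<noteq> 0 \<Longrightarrow> k \<in> blocks k q"
  by (force simp: blocks_def)

lemma card_blocks_le: "card (blocks k q) \<le> 2 * q"
proof (induction q)
  case (Suc q)
  have "card (blocks k (Suc q)) \<le>
    card (blocks k q) + card {q * (3 * k + 2) + k, q * (3 * k + 2) + 2 * k + 1}"
    unfolding blocks_Suc by (rule card_Un_le)
  with Suc show ?case by simp
qed (simp add: blocks_def)

lemma blocks_less: "s \<in> blocks k q \<Longrightarrow> s + k + 1 \<le> q * (3 * k + 2)"
  by (induction q) (auto simp: blocks_Suc blocks_def[of k 0])

lemma blocks_cover: "v < q * (3 * k + 2) \<Longrightarrow> \<exists>s\<in>blocks k q. v \<le> s + k \<and> s \<le> v + k"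
proof (induction q)
  case (Suc q)
  define P where "P = q * (3 * k + 2)"
  have blocks: "blocks k (Suc q) = blocks k q \<union> {P + k, P + 2 * k + 1}"
    by (simp add: blocks_Suc P_def)
  have v: "v < P + (3 * k + 2)" using Suc.prems by (simp add: P_def)
  consider "v < P" | "P \<le> v" "v \<le> P + 2 * k" | "P + 2 * k < v" by linarith
  then show ?case
  proof cases
    case 1
    then show ?thesis using Suc.IH by (auto simp: blocks P_def)
  next
    case 2
    then show ?thesis by (intro bexI[of _ "P + k"]) (auto simp: blocks)
  next
    case 3
    then show ?thesis using v by (intro bexI[of _ "P + 2 * k + 1"]) (auto simp: blocks)
  qed
qed simp

lemma blocks_partner:
  "s \<in> blocks k q \<Longrightarrow> \<exists>t\<in>blocks k q. t \<noteq> s \<and> t \<le> s + k + 1 \<and> s \<le> t + k + 1"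
  by (induction q) (auto simp: blocks_Suc blocks_def[of k 0])

text \<open>The bound \<open>B\<close> of the overview: a pair accounts for one window, an odd
  element for \<open>k + 1\<close> further vertices.\<close>

definition seen_bound :: "nat \<Rightarrow> nat \<Rightarrow> nat" where
  "seen_bound k m = m * (k + 1) + (m div 2) * k"

lemma seen_bound_mono: "m \<le> m' \<Longrightarrow> seen_bound k m \<le> seen_bound k m'"
  unfolding seen_bound_def by (intro add_mono mult_right_mono div_le_mono) auto

lemma seen_bound_even: "seen_bound k (2 * q) = q * (3 * k + 2)"
  by (simp add: seen_bound_def algebra_simps)

lemma seen_bound_odd: "seen_bound k (Suc (2 * q)) = q * (3 * k + 2) + k + 1"
  by (simp add: seen_bound_def algebra_simps)

section \<open>Resolving and dominating through signed offsets\<close>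

text \<open>
  Paths and cycles are treated uniformly: distances are absolute differences modulo \<open>N\<close>, where
  \<open>N = 0\<close> (congruence is equality) for the path and \<open>N = n\<close> for the cycle.
\<close>

locale path_or_cycle =
  fixes G :: "nat pair_pre_digraph" and n :: nat and N :: int
  assumes verts: "pverts G = {..<n}"
    and modulus: "N = 0 \<or> N = int n \<and> n \<ge> 3"
    and dist_le_iff: "\<And>x y d. x < n \<Longrightarrow> y < n \<Longrightarrow> graph_dist G x y \<le> enat d \<longleftrightarrow>
      (\<exists>i. \<bar>i\<bar> \<le> int d \<and> [int x = int y + i] (mod N))"
begin

text \<open>The sign of the offset keeps left and right meaningful on the cycle, where one vertex
  may have several offsets.\<close>

definition near :: "nat \<Rightarrow> nat \<Rightarrow> nat \<Rightarrow> bool" where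
  "near d x y \<longleftrightarrow> (\<exists>i. \<bar>i\<bar> \<le> int d \<and> [int x = int y + i] (mod N))"

lemma nearI: "[int x = int y + i] (mod N) \<Longrightarrow> \<bar>i\<bar> \<le> int d \<Longrightarrow> near d x y"
  by (auto simp: near_def)

lemma near_diffI: "\<bar>int x - int y\<bar> \<le> int d \<Longrightarrow> near d x y"
  by (rule nearI[of _ _ "int x - int y"]) auto

lemma near_self: "near d x x"
  by (rule near_diffI) simp

lemma near_mono: "near d x y \<Longrightarrow> d \<le> e \<Longrightarrow> near e x y"
  by (force simp: near_def)

lemma cong_imp_eq: "[int x = int y] (mod N) \<Longrightarrow> x < n \<Longrightarrow> y < n \<Longrightarrow> x = y"
  using modulus by (auto simp: cong_int_iff cong_def)

lemma resolving_iff: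
  "distance_resolving G k S \<longleftrightarrow> S \<subseteq> {..<n} \<and>
    (\<forall>x<n. \<forall>y<n. x \<noteq> y \<longrightarrow> (\<exists>z\<in>S. \<exists>d\<le>k. near d x z \<noteq> near d y z))"
proof (cases "S \<subseteq> {..<n}")
  case True
  then have "trunc_dist G k x z \<noteq> trunc_dist G k y z \<longleftrightarrow> (\<exists>d\<le>k. near d x z \<noteq> near d y z)"
    if "x < n" "y < n" "z \<in> S" for x y z
    using that by (auto simp: trunc_dist_def min_enat_eq_iff dist_le_iff near_def subset_iff
        simp del: One_nat_def add_Suc_right)
  then show ?thesis
    unfolding distance_resolving_def verts by (simp add: Ball_def lessThan_iff cong: conj_cong)
qed (auto simp: distance_resolving_def verts)

lemma dominating_iff:
  "distance_dominating G k S \<longleftrightarrow> S \<subseteq> {..<n} \<and> (\<forall>u<n. \<exists>w\<in>S. near k u w)"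
proof (cases "S \<subseteq> {..<n}")
  case True
  then have "graph_dist G u w \<le> enat k \<longleftrightarrow> near k u w" if "u < n" "w \<in> S" for u w
    using that by (auto simp: dist_le_iff near_def subset_iff)
  then have "distance_dominating G k S \<longleftrightarrow> (\<forall>u\<in>{..<n} - S. \<exists>w\<in>S. near k u w)"
    using True by (simp add: distance_dominating_def verts)
  also have "\<dots> \<longleftrightarrow> (\<forall>u<n. \<exists>w\<in>S. near k u w)"
    using near_self by blast
  finally show ?thesis using True by simp
qed (auto simp: distance_dominating_def verts)

text \<open>Distinct vertices at equal distance \<open>d\<close> from \<open>s\<close> must sit at
  the opposite offsets \<open>d\<close> and \<open>- d\<close>, which cancel in the sum.\<close>

lemma unresolved_cong:
  assumes "x < n" "y < n" "x \<noteq> y" "near k x s"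
    and same: "\<And>d. d \<le> k \<Longrightarrow> near d x s \<longleftrightarrow> near d y s"
  shows "[int x + int y = 2 * int s] (mod N)"
proof -
  \<comment> \<open>The distance from \<open>x\<close> to \<open>s\<close>. Being at most
    \<open>k\<close>, it is also that of \<open>y\<close>, and minimality forces both offsets to
    have absolute value exactly \<open>d\<close>.\<close>
  define d where "d = (LEAST d. near d x s)"
  have d: "near d x s" "d \<le> k" and least: "\<And>e. near e x s \<Longrightarrow> d \<le> e"
    unfolding d_def using assms(4) by (auto intro: LeastI Least_le)
  have "near d y s" using d same by blast
  with d obtain i j where i: "\<bar>i\<bar> \<le> int d" "[int x = int s + i] (mod N)"
    and j: "\<bar>j\<bar> \<le> int d" "[int y = int s + j] (mod N)"
    by (auto simp: near_def)
  have "near (nat \<bar>i\<bar>) x s" using i by (intro nearI) auto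
  then have "\<bar>i\<bar> = int d" using least i(1) by force
  moreover have "near (nat \<bar>j\<bar>) y s" using j by (intro nearI) auto
  then have "near (nat \<bar>j\<bar>) x s" using j(1) d(2) same by auto
  then have "\<bar>j\<bar> = int d" using least j(1) by force
  moreover have "i \<noteq> j" using i(2) j(2) assms(1-3) cong_imp_eq by (metis cong_sym cong_trans)
  ultimately have "j = - i" by linarith
  then show ?thesis using cong_add[OF i(2) j(2)] by simp
qed

text \<open>
  Two unresolved vertices seen from \<open>s\<close> have midpoint \<open>s\<close>; one of them is then also seen from
  the partner \<open>t\<close>, so their midpoint is \<open>t\<close> as well.
\<close>

lemma resolvingI:
  assumes "S \<subseteq> {..<n}"
    and partner: "\<And>s. s \<in> S \<Longrightarrow>
      (\<forall>x<n. \<forall>y<n. [int x + int y = 2 * int s] (mod N) \<longrightarrow> x = y) \<or>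
      (\<exists>t\<in>S. \<exists>g. \<bar>g\<bar> \<le> int k + 1 \<and> [int t = int s + g] (mod N) \<and> \<not> [2 * g = 0] (mod N))"
    and unseen: "\<And>x y. x < n \<Longrightarrow> y < n \<Longrightarrow> \<forall>s\<in>S. \<not> near k x s \<Longrightarrow> \<forall>s\<in>S. \<not> near k y s \<Longrightarrow> x = y"
  shows "distance_resolving G k S"
  unfolding resolving_iff
proof (intro conjI allI impI)
  show "S \<subseteq> {..<n}" by fact
next
  fix x y assume xy: "x < n" "y < n" "x \<noteq> y"
  show "\<exists>z\<in>S. \<exists>d\<le>k. near d x z \<noteq> near d y z"
  proof (rule ccontr)
    assume "\<not> ?thesis"
    then have same: "near d x z \<longleftrightarrow> near d y z" if "z \<in> S" "d \<le> k" for z d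
      using that by blast
    from unseen xy same obtain s where s: "s \<in> S" "near k x s" by blast
    have mid: "[int x + int y = 2 * int s] (mod N)"
      using unresolved_cong xy s same by blast
    \<comment> \<open>The first alternative of \<open>partner\<close>, made for an end of a path,
      contradicts \<open>mid\<close> and \<open>x \<noteq> y\<close>.\<close>
    with partner[OF s(1)] xy obtain t g where t: "t \<in> S" and g: "\<bar>g\<bar> \<le> int k + 1"
      "[int t = int s + g] (mod N)" "\<not> [2 * g = 0] (mod N)" by blast
    from s(2) obtain i where i: "\<bar>i\<bar> \<le> int k" "[int x = int s + i] (mod N)"
      by (auto simp: near_def)
    have y: "[int y = int s - i] (mod N)"
      using cong_diff[OF mid i(2)] by simp
    have "i \<noteq> 0" using i(2) y xy cong_imp_eq by (metis add_0_right cong_sym cong_trans diff_zero)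
    have "g \<noteq> 0" using g(3) by auto
    \<comment> \<open>Take the vertex on the same side of \<open>s\<close> as \<open>t\<close>:
      absolute offsets between 1 and \<open>k\<close> and between 1 and \<open>k + 1\<close> differ
      by at most \<open>k\<close>.\<close>
    have near_t: "near k x t \<or> near k y t"
    proof (cases "i > 0 \<longleftrightarrow> g > 0")
      case True
      have "[int x = int t + (i - g)] (mod N)"
        using cong_diff[OF i(2) g(2)] by (simp add: cong_iff_dvd_diff algebra_simps)
      moreover have "\<bar>i - g\<bar> \<le> int k" using True i(1) g(1) \<open>i \<noteq> 0\<close> \<open>g \<noteq> 0\<close> by linarith
      ultimately show ?thesis by (blast intro: nearI)
    next
      case False
      have "[int y = int t + (- i - g)] (mod N)"
        using cong_diff[OF y g(2)] by (simp add: cong_iff_dvd_diff algebra_simps)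
      moreover have "\<bar>- i - g\<bar> \<le> int k" using False i(1) g(1) \<open>i \<noteq> 0\<close> \<open>g \<noteq> 0\<close> by linarith
      ultimately show ?thesis by (blast intro: nearI)
    qed
    then have "near k x t" using same t by blast
    then have "[int x + int y = 2 * int t] (mod N)"
      using unresolved_cong xy t same by blast
    with mid have "[2 * int t = 2 * int s] (mod N)" by (metis cong_sym cong_trans)
    moreover have "[2 * int t = 2 * (int s + g)] (mod N)" using g(2) by (rule cong_scalar_left)
    ultimately have "[2 * (int s + g) = 2 * int s] (mod N)" by (metis cong_sym cong_trans)
    then show False using g(3) by (simp add: cong_iff_dvd_diff algebra_simps)
  qed
qed

section \<open>Counting the seen vertices\<close>

text \<open>An offset determines at most one vertex. Equality can fail: offsets may leave the path
  or coincide on the cycle.\<close>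

lemma card_offsets_le:
  assumes "finite I"
  shows "card {v. v < n \<and> (\<exists>i\<in>I. [int v = a + i] (mod N))} \<le> card I"
proof (rule card_le_if_inj_on_rel[where r = "\<lambda>v i. [int v = a + i] (mod N)"])
  fix v w i assume "v \<in> {v. v < n \<and> (\<exists>i\<in>I. [int v = a + i] (mod N))}"
    "w \<in> {v. v < n \<and> (\<exists>i\<in>I. [int v = a + i] (mod N))}"
    "[int v = a + i] (mod N)" "[int w = a + i] (mod N)"
  then show "v = w" using cong_imp_eq cong_sym cong_trans by blast
qed (use assms in auto)

text \<open>The reach is \<open>k + 1\<close>, not \<open>k\<close>, because a member that far to
  the left of \<open>s\<close> still sees the vertex just left of \<open>s\<close>. On a cycle with
  at most \<open>k + 1\<close> vertices \<open>t = s\<close> is possible.\<close>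

definition left_neighbour :: "nat \<Rightarrow> nat set \<Rightarrow> nat \<Rightarrow> bool" where
  "left_neighbour k S s \<longleftrightarrow> (\<exists>t\<in>S. \<exists>i\<in>{1..int k + 1}. [int s = int t + i] (mod N))"

definition right_neighbour :: "nat \<Rightarrow> nat set \<Rightarrow> nat \<Rightarrow> bool" where
  "right_neighbour k S s \<longleftrightarrow> (\<exists>t\<in>S. \<exists>i\<in>{1..int k + 1}. [int t = int s + i] (mod N))"

text \<open>The two adjacent vertices differ because \<open>n \<ge> 3\<close> does not divide
  2.\<close>

lemma neighbours_on_cycle:
  assumes "N \<noteq> 0"
  obtains x y where "x < n" "y < n" "x \<noteq> y"
    "[int x = int s - 1] (mod N)" "[int y = int s + 1] (mod N)"
proof -
  from assms modulus have N: "N = int n" "n \<ge> 3" by auto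
  define x where "x = nat ((int s - 1) mod N)"
  define y where "y = nat ((int s + 1) mod N)"
  have x: "int x = (int s - 1) mod N" and y: "int y = (int s + 1) mod N"
    using N by (simp_all add: x_def y_def)
  have "int x < int n" "int y < int n" using N by (simp_all add: x y)
  moreover have "x \<noteq> y"
  proof
    assume "x = y"
    then have "[int s + 1 = int s - 1] (mod N)" using x y by (simp add: cong_def)
    then have "int n dvd 2" using N by (simp add: cong_iff_dvd_diff)
    then show False using N(2) zdvd_imp_le by force
  qed
  moreover have "[int x = int s - 1] (mod N)" "[int y = int s + 1] (mod N)"
    by (simp_all add: x y cong_def)
  ultimately show ?thesis using that by simp
qed

text \<open>No member other than \<open>s\<close> sees either vertex adjacent to \<open>s\<close>,
  and \<open>s\<close> is at distance 1 from both. Only an end of a path lacks such a pair.\<close>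

lemma isolated_imp_end:
  assumes res: "distance_resolving G k S" and s: "s \<in> S"
    and isolated: "\<not> left_neighbour k S s" "\<not> right_neighbour k S s"
  shows "N = 0 \<and> (s = 0 \<or> s + 1 = n)"
proof (rule ccontr)
  assume inner: "\<not> ?thesis"
  have "S \<subseteq> {..<n}" using res by (simp add: resolving_iff)
  then have "s < n" using s by auto
  obtain x y where xy: "x < n" "y < n" "x \<noteq> y"
    and x: "[int x = int s - 1] (mod N)" and y: "[int y = int s + 1] (mod N)"
  proof (cases "N = 0")
    case True
    then show ?thesis using inner \<open>s < n\<close> that[of "s - 1" "s + 1"] by auto
  next
    case False
    then show ?thesis using neighbours_on_cycle that by blast
  qed
  have "near d x t \<longleftrightarrow> near d y t" if t: "t \<in> S" and "d \<le> k" for t d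
  proof
    assume "near d x t"
    then obtain i where i: "\<bar>i\<bar> \<le> int d" "[int x = int t + i] (mod N)" by (auto simp: near_def)
    have st: "[int s = int t + (i + 1)] (mod N)"
      using cong_trans[OF cong_sym[OF x] i(2)] by (simp add: cong_iff_dvd_diff algebra_simps)
    then have ts: "[int t = int s + (- i - 1)] (mod N)"
      using cong_sym by (fastforce simp: cong_iff_dvd_diff algebra_simps)
    have "\<not> i + 1 \<ge> 1"
      using isolated(1) st t i(1) \<open>d \<le> k\<close> by (auto simp: left_neighbour_def)
    moreover have "\<not> - i - 1 \<ge> 1"
      using isolated(2) ts t i(1) \<open>d \<le> k\<close> by (fastforce simp: right_neighbour_def)
    ultimately have "i = - 1" by linarith
    moreover from this st have "[int s = int t] (mod N)" by simp
    then have "s = t" using cong_imp_eq t s \<open>S \<subseteq> {..<n}\<close> by blast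
    ultimately show "near d y t" using i(1) y by (intro nearI[of _ _ "1"]) auto
  next
    assume "near d y t"
    then obtain i where i: "\<bar>i\<bar> \<le> int d" "[int y = int t + i] (mod N)" by (auto simp: near_def)
    have st: "[int s = int t + (i - 1)] (mod N)"
      using cong_trans[OF cong_sym[OF y] i(2)] by (simp add: cong_iff_dvd_diff algebra_simps)
    then have ts: "[int t = int s + (1 - i)] (mod N)"
      using cong_sym by (fastforce simp: cong_iff_dvd_diff algebra_simps)
    have "\<not> i - 1 \<ge> 1"
      using isolated(1) st t i(1) \<open>d \<le> k\<close> by (fastforce simp: left_neighbour_def)
    moreover have "\<not> 1 - i \<ge> 1"
      using isolated(2) ts t i(1) \<open>d \<le> k\<close> by (fastforce simp: right_neighbour_def)
    ultimately have "i = 1" by linarith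
    moreover from this st have "[int s = int t] (mod N)" by simp
    then have "s = t" using cong_imp_eq t s \<open>S \<subseteq> {..<n}\<close> by blast
    ultimately show "near d x t" using i(1) x by (intro nearI[of _ _ "- 1"]) auto
  qed
  then show False using res xy unfolding resolving_iff by blast
qed

text \<open>
  Each \<open>s \<in> S\<close> pays for the vertices it sees to its right, itself included. A vertex seen from the
  right only is paid for by the next \<open>s \<in> S\<close>, which then has no left neighbour and hence (being
  resolved) a right neighbour, unless it is an end of the path; this successor does not pay twice, so at most half of \<open>S\<close> does.
\<close>

lemma card_seen_le:
  assumes res: "distance_resolving G k S"
  shows "card {v. v < n \<and> (\<exists>s\<in>S. near k v s)} \<le> seen_bound k (card S)"
proof -
  have S: "S \<subseteq> {..<n}" using res by (simp add: resolving_iff)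
  then have fin: "finite S" by (rule finite_subset) simp
  define R where "R s = {v. v < n \<and> (\<exists>i\<in>{0..int k}. [int v = int s + i] (mod N))}" for s
  define L where "L s = {v. v < n \<and> (\<exists>i\<in>{- int k..-1}. [int v = int s + i] (mod N))}" for s
  define B where "B = {s \<in> S. right_neighbour k S s \<and> \<not> left_neighbour k S s}"
  \<comment> \<open>An isolated member pays for its left side too. As an end of a path it has
    vertices on one side only, so \<open>k + 1\<close> still suffices.\<close>
  define W where
    "W s = (if left_neighbour k S s \<or> right_neighbour k S s then R s else R s \<union> L s)" for s
  have "B \<subseteq> S" by (auto simp: B_def)
  then have "finite B" using fin by (rule finite_subset)
  have card_R: "card (R s) \<le> k + 1" and card_L: "card (L s) \<le> k" for s
    using card_offsets_le[of "{0..int k}" "int s"] card_offsets_le[of "{- int k..-1}" "int s"]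
    by (simp_all add: R_def L_def)
  have card_W: "card (W s) \<le> k + 1" if "s \<in> S" for s
  proof (cases "left_neighbour k S s \<or> right_neighbour k S s")
    case False
    with isolated_imp_end[OF res that] have "N = 0" and or: "s = 0 \<or> s + 1 = n" by auto
    from or show ?thesis
    proof
      assume "s = 0"
      then have "L s = {}" by (auto simp: L_def \<open>N = 0\<close>)
      then show ?thesis using card_R by (simp add: W_def)
    next
      assume "s + 1 = n"
      then have "W s \<subseteq> {v. v < n \<and> (\<exists>i\<in>{- int k..0}. [int v = int s + i] (mod N))}"
        using \<open>N = 0\<close> by (auto simp: W_def R_def L_def)
      then have "card (W s) \<le> card {v. v < n \<and> (\<exists>i\<in>{- int k..0}. [int v = int s + i] (mod N))}"
        by (intro card_mono) auto
      also have "\<dots> \<le> k + 1" using card_offsets_le[of "{- int k..0}" "int s"] by simp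
      finally show ?thesis .
    qed
  qed (use card_R in \<open>simp add: W_def\<close>)
  have cover: "{v. v < n \<and> (\<exists>s\<in>S. near k v s)} \<subseteq> (\<Union>s\<in>S. W s) \<union> (\<Union>s\<in>B. L s)"
  proof
    fix v assume "v \<in> {v. v < n \<and> (\<exists>s\<in>S. near k v s)}"
    then obtain s0 i0 where v: "v < n" and s0: "s0 \<in> S"
      and i0: "\<bar>i0\<bar> \<le> int k" "[int v = int s0 + i0] (mod N)"
      by (auto simp: near_def)
    show "v \<in> (\<Union>s\<in>S. W s) \<union> (\<Union>s\<in>B. L s)"
    proof (cases "\<exists>s\<in>S. v \<in> R s")
      case True
      then show ?thesis by (auto simp: W_def)
    next
      case False
      then have notR: "\<not> [int v = int s + i] (mod N)" if "s \<in> S" "0 \<le> i" "i \<le> int k" for s i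
        using that v by (auto simp: R_def)
      \<comment> \<open>The least such \<open>i\<close> leads from \<open>v\<close> to the next
        member on its right.\<close>
      define P where "P i \<longleftrightarrow> (\<exists>s\<in>S. [int v = int s - int i] (mod N))" for i
      have "i0 < 0" using notR[OF s0, of i0] i0 by linarith
      then have "P (nat (- i0))" using s0 i0(2) by (auto simp: P_def)
      define i where "i = (LEAST i. P i)"
      have "P i" and least: "\<And>j. P j \<Longrightarrow> i \<le> j"
        unfolding i_def using \<open>P (nat (- i0))\<close> by (auto intro: LeastI Least_le)
      then obtain s where s: "s \<in> S" "[int v = int s - int i] (mod N)" by (auto simp: P_def)
      have "i \<le> k" using least[OF \<open>P (nat (- i0))\<close>] i0(1) by linarith
      have "i \<noteq> 0" using notR[OF s(1), of 0] s(2) by (intro notI) simp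
      have "v \<in> L s"
        using v s(2) \<open>i \<le> k\<close> \<open>i \<noteq> 0\<close> by (auto simp: L_def intro!: bexI[of _ "- int i"])
      moreover have "\<not> left_neighbour k S s"
      proof
        assume "left_neighbour k S s"
        then obtain t j where t: "t \<in> S" "1 \<le> j" "j \<le> int k + 1" "[int s = int t + j] (mod N)"
          by (auto simp: left_neighbour_def)
        have vt: "[int v = int t + (j - int i)] (mod N)"
          using cong_trans[OF s(2) cong_diff[OF t(4) cong_refl]] by (simp add: algebra_simps)
        \<comment> \<open>Otherwise \<open>t\<close> would see \<open>v\<close> to its right, since
          \<open>i \<ge> 1\<close> turns the reach \<open>k + 1\<close> into
          \<open>j - i \<le> k\<close>. So \<open>t\<close> lies strictly between \<open>v\<close>
          and \<open>s\<close>, against the choice of \<open>i\<close>.\<close>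
        then have "j < int i" using notR[OF t(1), of "j - int i"] t(3) \<open>i \<noteq> 0\<close> by linarith
        moreover from this have "P (nat (int i - j))"
          using vt t(1) by (auto simp: P_def algebra_simps intro!: bexI[of _ t])
        ultimately show False using least t(2) by fastforce
      qed
      ultimately show ?thesis using s(1) by (auto simp: W_def B_def)
    qed
  qed
  \<comment> \<open>Sends \<open>s\<close> in \<open>B\<close> to its successor, which lies outside
    \<open>B\<close> because \<open>s\<close> is its left neighbour.\<close>
  define r where "r s t \<longleftrightarrow> (\<exists>i\<in>{1..k + 1}. [int t = int s + int i] (mod N) \<and>
      (\<forall>j\<in>{1..<i}. \<forall>u\<in>S. \<not> [int u = int s + int j] (mod N)))" for s t
  have "card B \<le> card (S - B)"
  proof (rule card_le_if_inj_on_rel[where r = r])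
    fix s assume "s \<in> B"
    define P where "P i \<longleftrightarrow> 1 \<le> i \<and> (\<exists>t\<in>S. [int t = int s + int i] (mod N))" for i
    define i where "i = (LEAST i. P i)"
    from \<open>s \<in> B\<close> obtain t0 i0 where "t0 \<in> S" "1 \<le> i0" "i0 \<le> int k + 1"
      "[int t0 = int s + i0] (mod N)" by (auto simp: B_def right_neighbour_def)
    then have "P (nat i0)" "nat i0 \<le> k + 1" by (auto simp: P_def)
    then have "P i" "i \<le> k + 1" and least: "\<And>j. P j \<Longrightarrow> i \<le> j"
      unfolding i_def by (auto intro: LeastI Least_le order.trans)
    then obtain t where t: "t \<in> S" "[int t = int s + int i] (mod N)" "1 \<le> i" by (auto simp: P_def)
    have "r s t"
      unfolding r_def using t \<open>i \<le> k + 1\<close> least by (intro bexI[of _ i]) (force simp: P_def)+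
    moreover have "left_neighbour k S t"
      unfolding left_neighbour_def using t \<open>i \<le> k + 1\<close> \<open>s \<in> B\<close> \<open>B \<subseteq> S\<close>
      by (intro bexI[of _ s] bexI[of _ "int i"]) auto
    ultimately show "\<exists>t. t \<in> S - B \<and> r s t" using t(1) by (auto simp: B_def)
  next
    \<comment> \<open>Members with a common successor coincide: otherwise \<open>s1\<close> would
      come strictly between \<open>s2\<close> and \<open>t\<close>.\<close>
    have step: "s1 = s2" if s: "s1 \<in> S" "s2 \<in> S" and "i1 \<le> i2"
      and 1: "[int t = int s1 + int i1] (mod N)" "1 \<le> i1"
      and 2: "[int t = int s2 + int i2] (mod N)"
        "\<forall>j\<in>{1..<i2}. \<forall>u\<in>S. \<not> [int u = int s2 + int j] (mod N)" for s1 s2 t i1 i2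
    proof -
      have "[int s1 + int i1 = int s2 + int i2] (mod N)"
        using cong_trans[OF cong_sym[OF 1(1)] 2(1)] .
      then have c: "[int s1 = int s2 + int (i2 - i1)] (mod N)"
        using \<open>i1 \<le> i2\<close> by (simp add: cong_iff_dvd_diff of_nat_diff algebra_simps)
      then have "i2 - i1 \<notin> {1..<i2}" using 2(2) s by blast
      then have "i2 = i1" using \<open>i1 \<le> i2\<close> 1(2) by auto
      then show ?thesis using c cong_imp_eq s S by auto
    qed
    fix s1 s2 t assume *: "s1 \<in> B" "s2 \<in> B" "r s1 t" "r s2 t"
    then obtain i1 i2 where
      "[int t = int s1 + int i1] (mod N)" "1 \<le> i1"
      "\<forall>j\<in>{1..<i1}. \<forall>u\<in>S. \<not> [int u = int s1 + int j] (mod N)"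
      "[int t = int s2 + int i2] (mod N)" "1 \<le> i2"
      "\<forall>j\<in>{1..<i2}. \<forall>u\<in>S. \<not> [int u = int s2 + int j] (mod N)"
      unfolding r_def by fastforce
    with * \<open>B \<subseteq> S\<close> show "s1 = s2"
      using step[of s1 s2 i1 i2 t] step[of s2 s1 i2 i1 t] by (metis nat_le_linear subsetD)
  qed (use fin in simp)
  then have "card B \<le> card S div 2"
    using card_Diff_subset[OF \<open>finite B\<close> \<open>B \<subseteq> S\<close>] card_mono[OF fin \<open>B \<subseteq> S\<close>] by linarith
  have "card {v. v < n \<and> (\<exists>s\<in>S. near k v s)} \<le> card ((\<Union>s\<in>S. W s) \<union> (\<Union>s\<in>B. L s))"
    using cover fin \<open>finite B\<close> by (intro card_mono) (auto simp: W_def R_def L_def)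
  also have "\<dots> \<le> card (\<Union>s\<in>S. W s) + card (\<Union>s\<in>B. L s)"
    by (rule card_Un_le)
  also have "\<dots> \<le> (\<Sum>s\<in>S. card (W s)) + (\<Sum>s\<in>B. card (L s))"
    using fin \<open>finite B\<close> by (intro add_mono card_UN_le)
  also have "\<dots> \<le> (\<Sum>s\<in>S. k + 1) + (\<Sum>s\<in>B. k)"
    by (intro add_mono sum_mono card_W card_L)
  also have "\<dots> = card S * (k + 1) + card B * k"
    by simp
  also have "\<dots> \<le> seen_bound k (card S)"
    unfolding seen_bound_def
    using \<open>card B \<le> card S div 2\<close> by (intro add_left_mono mult_right_mono) auto
  finally show ?thesis .
qed

lemma locating_dominating_bound:
  assumes "distance_locating_dominating G k S"
  shows "n \<le> seen_bound k (card S)"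
proof -
  have "{v. v < n \<and> (\<exists>s\<in>S. near k v s)} = {..<n}"
    using assms by (auto simp: distance_locating_dominating_def dominating_iff)
  with card_seen_le[of k S] assms show ?thesis
    by (simp add: distance_locating_dominating_def)
qed

text \<open>Two vertices seen by no member fail every threshold test up to \<open>k\<close>, hence
  are unresolved.\<close>

lemma resolving_bound:
  assumes "distance_resolving G k S"
  shows "n \<le> seen_bound k (card S) + 1"
proof -
  let ?seen = "{v. v < n \<and> (\<exists>s\<in>S. near k v s)}"
  have "x = y" if "x \<in> {..<n} - ?seen" "y \<in> {..<n} - ?seen" for x y
    using that assms near_mono unfolding resolving_iff by blast
  then have "card ({..<n} - ?seen) \<le> 1"
    by (simp add: card_le_Suc0_iff_eq del: Diff_iff)
  moreover have "card ({..<n} - ?seen) = n - card ?seen"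
    by (subst card_Diff_subset) auto
  ultimately show ?thesis using card_seen_le[OF assms] by linarith
qed

section \<open>Sets attaining the bounds\<close>

text \<open>A test by plain differences of positions. The last vertex needs no partner on a path,
  where it is the midpoint of no two distinct vertices; on a cycle its partner is \<open>k\<close>,
  reached in \<open>k + 1\<close> steps across 0.\<close>

lemma spread_resolving:
  assumes S: "S \<subseteq> {..<n}"
    and partner: "\<And>s. s \<in> S \<Longrightarrow> s + 1 = n \<or> (\<exists>t\<in>S. t \<noteq> s \<and> t \<le> s + k + 1 \<and> s \<le> t + k + 1)"
    and cycle: "N \<noteq> 0 \<Longrightarrow> 2 * k + 3 \<le> n" "N \<noteq> 0 \<Longrightarrow> n - 1 \<in> S \<Longrightarrow> k \<in> S"
    and unseen: "\<And>x y. x < n \<Longrightarrow> y < n \<Longrightarrow> \<forall>s\<in>S. s + k < x \<or> x + k < s \<Longrightarrow>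
      \<forall>s\<in>S. s + k < y \<or> y + k < s \<Longrightarrow> x = y"
  shows "distance_resolving G k S"
proof (rule resolvingI[OF S])
  fix x y assume "x < n" "y < n" "\<forall>s\<in>S. \<not> near k x s" "\<forall>s\<in>S. \<not> near k y s"
  then show "x = y" using near_diffI by (intro unseen) (force simp: not_le)+
next
  fix s assume s: "s \<in> S"
  \<comment> \<open>\<open>2 * g\<close> is nonzero with absolute value at most
    \<open>2 * k + 2\<close>, below \<open>n\<close> on a cycle.\<close>
  have double: "\<not> [2 * g = 0] (mod N)" if "\<bar>g\<bar> \<le> int k + 1" "g \<noteq> 0" for g
  proof (cases "N = 0")
    case False
    with modulus cycle(1) have "N = int n" "2 * k + 3 \<le> n" by auto
    then show ?thesis using that dvd_imp_le_int[of "2 * g" "int n"] by (auto simp: cong_0_iff)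
  qed (use that in simp)
  consider "s + 1 = n" "N = 0" | "s + 1 = n" "N \<noteq> 0"
    | t where "t \<in> S" "t \<noteq> s" "t \<le> s + k + 1" "s \<le> t + k + 1"
    using partner[OF s] by blast
  then show "(\<forall>x<n. \<forall>y<n. [int x + int y = 2 * int s] (mod N) \<longrightarrow> x = y) \<or>
    (\<exists>t\<in>S. \<exists>g. \<bar>g\<bar> \<le> int k + 1 \<and> [int t = int s + g] (mod N) \<and> \<not> [2 * g = 0] (mod N))"
  proof cases
    case 1
    then show ?thesis by auto
  next
    case 2
    with modulus have "N = int n" by auto
    have "s = n - 1" using 2(1) by simp
    then have "k \<in> S" using s cycle(2)[OF 2(2)] by simp
    moreover have "[int k = int s + (int k + 1)] (mod N)"
    proof -
      have "int k - (int s + (int k + 1)) = - int n" using 2(1) by simp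
      then show ?thesis unfolding cong_iff_dvd_diff \<open>N = int n\<close> by simp
    qed
    ultimately show ?thesis using double[of "int k + 1"] by (intro disjI2 bexI[of _ k] exI[of _ "int k + 1"]) auto
  next
    case 3
    then show ?thesis using double[of "int t - int s"]
      by (intro disjI2 bexI[of _ t] exI[of _ "int t - int s"]) auto
  qed
qed

lemma spread_dominating:
  assumes "S \<subseteq> {..<n}" "\<And>v. v < n \<Longrightarrow> \<exists>s\<in>S. v \<le> s + k \<and> s \<le> v + k"
  shows "distance_dominating G k S"
  unfolding dominating_iff
proof (intro conjI allI impI)
  fix v assume "v < n"
  then obtain s where "s \<in> S" "v \<le> s + k" "s \<le> v + k" using assms(2) by blast
  then show "\<exists>s\<in>S. near k v s" by (intro bexI[of _ s] near_diffI) auto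
qed (rule assms(1))

lemma locating_dominating_upper:
  assumes n: "n = q * (3 * k + 2) + r" "1 \<le> r" "r \<le> 3 * k + 2"
    and cycle: "N \<noteq> 0 \<Longrightarrow> 2 * k + 3 \<le> n"
  shows "\<exists>S. distance_locating_dominating G k S \<and> card S \<le> (if r \<le> k + 1 then 2 * q + 1 else 2 * q + 2)"
proof -
  define P where "P = q * (3 * k + 2)"
  \<comment> \<open>The vertex \<open>n - 1\<close> sees the last \<open>k + 1\<close> vertices,
    enough for a short rest. A longer rest takes one more window cut off at \<open>n - 1\<close>;
    \<open>r \<ge> k + 2\<close> keeps its two members distinct.\<close>
  define T where "T = (if r \<le> k + 1 then {n - 1} else {P + k, min (n - 1) (P + 2 * k + 1)})"
  let ?S = "blocks k q \<union> T"
  have nP: "n = P + r" using n(1) by (simp add: P_def)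
  have blocks: "s + k + 1 \<le> P" if "s \<in> blocks k q" for s
    using blocks_less[OF that] by (simp add: P_def)
  have sub: "?S \<subseteq> {..<n}"
    using blocks n(2) nP by (force simp: T_def split: if_splits)
  have dom: "\<exists>s\<in>?S. v \<le> s + k \<and> s \<le> v + k" if "v < n" for v
  proof (cases "v < P")
    case True
    then show ?thesis using blocks_cover[of v q k] by (auto simp: P_def)
  next
    case False
    show ?thesis
    proof (cases "r \<le> k + 1 \<or> v > P + 2 * k")
      case True
      then show ?thesis using False that nP n(3)
        by (intro bexI[of _ "if r \<le> k + 1 then n - 1 else min (n - 1) (P + 2 * k + 1)"])
          (auto simp: T_def)
    next
      case other: False
      then show ?thesis using False that by (intro bexI[of _ "P + k"]) (auto simp: T_def)
    qed
  qed
  have "distance_resolving G k ?S"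
  proof (rule spread_resolving[OF sub])
    fix s assume s: "s \<in> ?S"
    show "s + 1 = n \<or> (\<exists>t\<in>?S. t \<noteq> s \<and> t \<le> s + k + 1 \<and> s \<le> t + k + 1)"
    proof (cases "s \<in> blocks k q")
      case True
      then show ?thesis using blocks_partner by blast
    next
      case False
      with s have "s \<in> T" by blast
      show ?thesis
      proof (cases "r \<le> k + 1")
        case True
        then show ?thesis using \<open>s \<in> T\<close> nP n(2) by (auto simp: T_def)
      next
        case False
        then have T: "T = {P + k, min (n - 1) (P + 2 * k + 1)}" by (simp add: T_def)
        consider "s = P + k" | "s = min (n - 1) (P + 2 * k + 1)" using \<open>s \<in> T\<close> T by blast
        then show ?thesis
        proof cases
          case 1
          then show ?thesis using False nP T
            by (intro disjI2 bexI[of _ "min (n - 1) (P + 2 * k + 1)"]) auto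
        next
          case 2
          then show ?thesis using False nP T by (intro disjI2 bexI[of _ "P + k"]) auto
        qed
      qed
    qed
  next
    assume "N \<noteq> 0"
    then have "2 * k + 3 \<le> n" by (rule cycle)
    show "k \<in> ?S"
    proof (cases "q = 0")
      case True
      then show ?thesis using \<open>2 * k + 3 \<le> n\<close> nP by (simp add: P_def T_def)
    next
      case False
      then show ?thesis using blocks_first by blast
    qed
  next
    fix x y assume "x < n" "\<forall>s\<in>?S. s + k < x \<or> x + k < s"
    with dom[of x] show "x = y" by (meson leD)
  qed (use cycle in auto)
  then have "distance_locating_dominating G k ?S"
    using spread_dominating[OF sub dom] by (simp add: distance_locating_dominating_def)
  moreover have "card ?S \<le> (if r \<le> k + 1 then 2 * q + 1 else 2 * q + 2)"
  proof -
    have "card T \<le> (if r \<le> k + 1 then 1 else 2)"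
      by (auto simp: T_def card_insert_if)
    then show ?thesis using card_Un_le[of "blocks k q" T] card_blocks_le[of k q] by auto
  qed
  ultimately show ?thesis by blast
qed

lemma resolving_upper:
  assumes n: "n = q * (3 * k + 2) + r" "r = 1 \<and> q \<ge> 1 \<or> r = k + 2"
    and cycle: "N \<noteq> 0 \<Longrightarrow> 2 * k + 3 \<le> n"
  shows "\<exists>S. distance_resolving G k S \<and> card S \<le> (if r = 1 then 2 * q else 2 * q + 1)"
proof -
  define P where "P = q * (3 * k + 2)"
  \<comment> \<open>In both cases only \<open>P\<close> may stay unseen: it is the last vertex if
    \<open>r = 1\<close>, while for \<open>r = k + 2\<close> the vertex \<open>n - 1\<close> sees
    everything after \<open>P\<close>.\<close>
  define T where "T = (if r = 1 then {} else {n - 1})"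
  let ?S = "blocks k q \<union> T"
  have nP: "n = P + r" using n(1) by (simp add: P_def)
  have blocks: "s + k + 1 \<le> P" if "s \<in> blocks k q" for s
    using blocks_less[OF that] by (simp add: P_def)
  have sub: "?S \<subseteq> {..<n}"
    using blocks n(2) nP by (force simp: T_def split: if_splits)
  have unseen: "x = P" if "x < n" "\<forall>s\<in>?S. s + k < x \<or> x + k < s" for x
  proof (rule ccontr)
    assume "x \<noteq> P"
    then have "x < P \<or> P < x \<and> r = k + 2 \<and> r \<noteq> 1" using n(2) nP that(1) by auto
    then consider "x < P" | "P < x" "r = k + 2" "r \<noteq> 1" by blast
    then show False
    proof cases
      case 1
      then obtain s where s: "s \<in> blocks k q" "x \<le> s + k" "s \<le> x + k"
        using blocks_cover unfolding P_def by blast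
      then have "s + k < x \<or> x + k < s" using that(2) by blast
      with s(2,3) show ?thesis by linarith
    next
      case 2
      then have "n - 1 \<in> ?S" by (simp add: T_def)
      with that have "n - 1 + k < x \<or> x + k < n - 1" by blast
      then show ?thesis using 2 nP that(1) by linarith
    qed
  qed
  have "distance_resolving G k ?S"
  proof (rule spread_resolving[OF sub])
    fix s assume s: "s \<in> ?S"
    show "s + 1 = n \<or> (\<exists>t\<in>?S. t \<noteq> s \<and> t \<le> s + k + 1 \<and> s \<le> t + k + 1)"
    proof (cases "s \<in> blocks k q")
      case True
      then show ?thesis using blocks_partner by blast
    next
      case False
      with s show ?thesis using nP n(2) by (auto simp: T_def split: if_splits)
    qed
  next
    assume "N \<noteq> 0"
    then have "2 * k + 3 \<le> n" by (rule cycle)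
    then have "q \<noteq> 0" using n by (cases "q = 0") auto
    then show "k \<in> ?S" using blocks_first by blast
  next
    fix x y assume "x < n" "\<forall>s\<in>?S. s + k < x \<or> x + k < s" "y < n" "\<forall>s\<in>?S. s + k < y \<or> y + k < s"
    then show "x = y" using unseen[of x] unseen[of y] by simp
  qed (use cycle in auto)
  moreover have "card ?S \<le> (if r = 1 then 2 * q else 2 * q + 1)"
    using card_Un_le[of "blocks k q" T] card_blocks_le[of k q] by (auto simp: T_def)
  ultimately show ?thesis by blast
qed

section \<open>Exact values\<close>

lemma distance_dimension_eqI:
  assumes "distance_resolving G k S" "card S \<le> m" "\<And>T. distance_resolving G k T \<Longrightarrow> m \<le> card T"
  shows "distance_dimension G k = m"
  unfolding distance_dimension_def
proof (rule Least_equality)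
  have "finite S" using assms(1) finite_subset by (auto simp: resolving_iff)
  then show "\<exists>S. finite S \<and> distance_resolving G k S \<and> card S = m"
    using assms by (intro exI[of _ S]) (simp add: le_antisym)
qed (use assms(3) in blast)

lemma distance_location_domination_number_eqI:
  assumes "distance_locating_dominating G k S" "card S \<le> m"
    "\<And>T. distance_locating_dominating G k T \<Longrightarrow> m \<le> card T"
  shows "distance_location_domination_number G k = m"
  unfolding distance_location_domination_number_def
proof (rule Least_equality)
  have "finite S"
    using assms(1) finite_subset by (auto simp: distance_locating_dominating_def dominating_iff)
  then show "\<exists>S. finite S \<and> distance_locating_dominating G k S \<and> card S = m"
    using assms by (intro exI[of _ S]) (simp add: le_antisym)
qed (use assms(3) in blast)

text \<open>The remainder runs from 1 to \<open>3 * k + 2\<close>, so \<open>n\<close> exceeds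
  \<open>seen_bound k (2 * q)\<close> and is at most \<open>seen_bound k (2 * q + 2)\<close>;
  \<open>k + 1\<close> marks the odd value between them.\<close>

lemma distance_location_domination_number_value:
  assumes n: "n = q * (3 * k + 2) + r" "1 \<le> r" "r \<le> 3 * k + 2"
    and cycle: "N \<noteq> 0 \<Longrightarrow> 2 * k + 3 \<le> n"
  shows "distance_location_domination_number G k = (if r \<le> k + 1 then 2 * q + 1 else 2 * q + 2)"
proof -
  obtain S where "distance_locating_dominating G k S"
    "card S \<le> (if r \<le> k + 1 then 2 * q + 1 else 2 * q + 2)"
    using locating_dominating_upper[OF assms] by blast
  then show ?thesis
  proof (rule distance_location_domination_number_eqI)
    fix T assume "distance_locating_dominating G k T"
    then have le: "n \<le> seen_bound k (card T)"
      by (rule locating_dominating_bound)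
    have "\<not> card T \<le> 2 * q"
      using le seen_bound_mono[of "card T" "2 * q" k] n by (auto simp: seen_bound_even)
    moreover have "\<not> card T \<le> 2 * q + 1" if "k + 1 < r"
      using le seen_bound_mono[of "card T" "2 * q + 1" k] n(1) that by (auto simp: seen_bound_odd)
    ultimately show "(if r \<le> k + 1 then 2 * q + 1 else 2 * q + 2) \<le> card T" by auto
  qed
qed

text \<open>The one permitted unseen vertex moves each threshold for \<open>r\<close> up by one, so
  only \<open>r = 1\<close> and \<open>r = k + 2\<close> need sets other than the
  locating-dominating ones.\<close>

lemma distance_dimension_value:
  assumes n: "n = q * (3 * k + 2) + r" "1 \<le> r" "r \<le> 3 * k + 2" "2 \<le> n"
    and cycle: "N \<noteq> 0 \<Longrightarrow> 2 * k + 3 \<le> n"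
  shows "distance_dimension G k = (if r = 1 then 2 * q else if r \<le> k + 2 then 2 * q + 1 else 2 * q + 2)"
proof -
  let ?m = "if r = 1 then 2 * q else if r \<le> k + 2 then 2 * q + 1 else 2 * q + 2"
  have q: "q \<ge> 1" if "r = 1" using n(1,4) that by (cases "q = 0") auto
  obtain S where "distance_resolving G k S" "card S \<le> ?m"
  proof (cases "r = 1 \<or> r = k + 2")
    case True
    then show ?thesis using resolving_upper[OF n(1) _ cycle] q that by (auto split: if_splits)
  next
    case False
    then have "(if r \<le> k + 1 then 2 * q + 1 else 2 * q + 2) = ?m" by auto
    then show ?thesis using locating_dominating_upper[OF n(1-3) cycle] that
      by (auto simp: distance_locating_dominating_def)
  qed
  then show ?thesis
  proof (rule distance_dimension_eqI)
    fix T assume "distance_resolving G k T"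
    then have le: "n \<le> seen_bound k (card T) + 1"
      by (rule resolving_bound)
    have "\<not> card T < 2 * q" if "r = 1"
    proof
      assume "card T < 2 * q"
      \<comment> \<open>Writes the largest forbidden size \<open>2 * q - 1\<close> as the odd number
        \<open>2 * p + 1\<close>.\<close>
      from q[OF that] obtain p where p: "q = Suc p" by (cases q) auto
      with \<open>card T < 2 * q\<close> have "seen_bound k (card T) \<le> seen_bound k (2 * p + 1)"
        by (intro seen_bound_mono) auto
      with le n(1,2) p show False by (simp add: seen_bound_odd)
    qed
    moreover have "\<not> card T \<le> 2 * q" if "r \<noteq> 1"
      using le seen_bound_mono[of "card T" "2 * q" k] n(1,2) that by (auto simp: seen_bound_even)
    moreover have "\<not> card T \<le> 2 * q + 1" if "k + 2 < r"
      using le seen_bound_mono[of "card T" "2 * q + 1" k] n(1) that by (auto simp: seen_bound_odd)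
    ultimately show "?m \<le> card T" by auto
  qed
qed

section \<open>Short cycles\<close>

text \<open>The reflection in a single element \<open>s\<close> preserves distances to
  \<open>s\<close> and swaps its two adjacent vertices. For empty \<open>S\<close> any
  \<open>s\<close> serves.\<close>

lemma two_le_card_resolving:
  assumes "N \<noteq> 0" "distance_resolving G k S"
  shows "2 \<le> card S"
proof (rule ccontr)
  assume "\<not> 2 \<le> card S"
  have S: "S \<subseteq> {..<n}" using assms(2) by (simp add: resolving_iff)
  then have "finite S" by (rule finite_subset) simp
  have "n \<ge> 3" using modulus assms(1) by auto
  obtain s where s: "s < n" "S \<subseteq> {s}"
  proof (cases "S = {}")
    case True
    then show ?thesis using that[of 0] \<open>n \<ge> 3\<close> by simp
  next
    case False
    with \<open>\<not> 2 \<le> card S\<close> \<open>finite S\<close> have "card S = 1"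
      by (metis One_nat_def Suc_1 card_0_eq le_antisym not_less_eq_eq not_one_le_zero le_zero_eq)
    then show ?thesis using that S by (auto simp: card_1_singleton_iff)
  qed
  from neighbours_on_cycle[OF assms(1), of s] obtain x y where xy: "x < n" "y < n" "x \<noteq> y"
    and x: "[int x = int s - 1] (mod N)" and y: "[int y = int s + 1] (mod N)" by blast
  have sum: "[int x + int y = 2 * int s] (mod N)" using cong_add[OF x y] by simp
  have reflect: "near d w s" if "near d v s" "[int v + int w = 2 * int s] (mod N)" for d v w
  proof -
    from that(1) obtain i where i: "\<bar>i\<bar> \<le> int d" "[int v = int s + i] (mod N)"
      by (auto simp: near_def)
    have "[int w = int s + - i] (mod N)" using cong_diff[OF that(2) i(2)] by simp
    then show ?thesis by (rule nearI) (use i(1) in simp)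
  qed
  then have "near d x s \<longleftrightarrow> near d y s" for d
    using sum by (metis add.commute)
  then show False using assms(2) xy s(2) unfolding resolving_iff by blast
qed

text \<open>From both sides 0 sees everything except possibly \<open>k + 1\<close>, which 1 sees.
  Adjacent partners have offset 1 or -1, and \<open>n \<ge> 3\<close> does not divide 2.\<close>

lemma short_cycle:
  assumes "N \<noteq> 0" "n \<le> 2 * k + 2" "k \<ge> 1"
  shows "distance_locating_dominating G k {0, 1}"
proof -
  have N: "N = int n" "n \<ge> 3" using modulus assms(1) by auto
  have dom: "\<exists>s\<in>{0, 1}. near k v s" if "v < n" for v
  proof -
    consider "v \<le> k" | "v = k + 1" | "k + 2 \<le> v" by linarith
    then show ?thesis
    proof cases
      case 1
      then have "near k v 0" by (intro near_diffI) auto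
      then show ?thesis by blast
    next
      case 2
      then have "near k v 1" by (intro near_diffI) auto
      then show ?thesis by blast
    next
      case 3
      have "near k v 0" using 3 that N assms(2)
        by (intro nearI[of _ _ "int v - int n"]) (auto simp: cong_iff_dvd_diff)
      then show ?thesis by blast
    qed
  qed
  have two: "\<not> [2 = 0] (mod N)" "\<not> [- 2 = 0] (mod N)"
    using N zdvd_imp_le[of "int n" 2] by (auto simp: cong_0_iff)
  have "distance_resolving G k {0, 1}"
  proof (rule resolvingI)
    fix s :: nat assume "s \<in> {0, 1}"
    then consider "s = 0" | "s = 1" by blast
    then show "(\<forall>x<n. \<forall>y<n. [int x + int y = 2 * int s] (mod N) \<longrightarrow> x = y) \<or>
      (\<exists>t\<in>{0, 1}. \<exists>g. \<bar>g\<bar> \<le> int k + 1 \<and> [int t = int s + g] (mod N) \<and> \<not> [2 * g = 0] (mod N))"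
    proof cases
      case 1
      then show ?thesis using two by (intro disjI2 bexI[of _ 1] exI[of _ 1]) auto
    next
      case 2
      then show ?thesis using two by (intro disjI2 bexI[of _ 0] exI[of _ "- 1"]) auto
    qed
  qed (use dom N in auto)
  then show ?thesis
    using dom N by (auto simp: distance_locating_dominating_def dominating_iff)
qed

lemma short_cycle_values:
  assumes "N \<noteq> 0" "n \<le> 2 * k + 2" "k \<ge> 1"
  shows "distance_dimension G k = 2" "distance_location_domination_number G k = 2"
  using short_cycle[OF assms] two_le_card_resolving[OF assms(1)]
  by (auto intro!: distance_dimension_eqI distance_location_domination_number_eqI
      simp: distance_locating_dominating_def)

end

section \<open>The two families of graphs\<close>

lemma path_or_cycle_path_graph: "path_or_cycle (path_graph n) n 0"
  by unfold_locales (auto simp: path_graph_simps graph_dist_path_graph)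

lemma path_or_cycle_cycle_graph: "n \<ge> 3 \<Longrightarrow> path_or_cycle (cycle_graph n) n (int n)"
  by unfold_locales (auto simp: cycle_graph_simps graph_dist_cycle_graph)

text \<open>Keeps clause (ii) from applying to a cycle.\<close>

lemma path_graph_neq_cycle_graph:
  assumes "n \<ge> 3"
  shows "path_graph n \<noteq> cycle_graph n"
proof
  assume "path_graph n = cycle_graph n"
  moreover have "(0, n - 1) \<in> parcs (cycle_graph n)" using assms by (simp add: cycle_graph_simps)
  ultimately have "(0, n - 1) \<in> parcs (path_graph n)" by simp
  then show False using assms by (simp add: path_graph_simps)
qed

lemma cong_iff_eq_residue:
  fixes q p r c :: nat
  assumes "1 \<le> r" "r \<le> p" "1 \<le> c" "c < p"
  shows "[q * p + r = c] (mod p) \<longleftrightarrow> r = c"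
  using assms by (cases "r = p") (auto simp: cong_def)

theorem proposition4p7:
  fixes n k :: nat and G :: "nat pair_pre_digraph"
  assumes "k \<ge> 1"
    and "(G = path_graph n \<and> n \<ge> 2) \<or> (G = cycle_graph n \<and> n \<ge> 3)"
  shows
    "if (G \<in> {path_graph n, cycle_graph n} \<and> [n = 1] (mod (3 * k + 2))) \<or>
        (G = path_graph n \<and> [n = k + 2] (mod (3 * k + 2))) \<or>
        (G = cycle_graph n \<and> n \<ge> 3 * k + 4 \<and> [n = k + 2] (mod (3 * k + 2)))
     then distance_location_domination_number G k = distance_dimension G k + 1
     else distance_location_domination_number G k = distance_dimension G k"
proof -
  define q where "q = (n - 1) div (3 * k + 2)"
  \<comment> \<open>Dividing \<open>n - 1\<close> rather than \<open>n\<close> gives a remainder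
    from 1 to \<open>3 * k + 2\<close>.\<close>
  define r where "r = (n - 1) mod (3 * k + 2) + 1"
  have "n \<ge> 2" using assms(2) by auto
  then have n: "n = q * (3 * k + 2) + r"
    using div_mult_mod_eq[of "n - 1" "3 * k + 2"] by (simp add: q_def r_def)
  have r: "1 \<le> r" "r \<le> 3 * k + 2"
    using mod_less_divisor[of "3 * k + 2" "n - 1"] by (simp_all add: r_def)
  have one: "[n = 1] (mod (3 * k + 2)) \<longleftrightarrow> r = 1"
    unfolding n using r by (intro cong_iff_eq_residue) auto
  have k2: "[n = k + 2] (mod (3 * k + 2)) \<longleftrightarrow> r = k + 2"
    unfolding n using r assms(1) by (intro cong_iff_eq_residue) auto
  from assms(2) show ?thesis
  proof
    assume G: "G = path_graph n \<and> n \<ge> 2"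
    interpret path_or_cycle G n 0 using G path_or_cycle_path_graph by simp
    show ?thesis
      using G assms(1) distance_dimension_value[OF n r \<open>n \<ge> 2\<close>]
        distance_location_domination_number_value[OF n r]
      unfolding one k2 by auto
  next
    assume G: "G = cycle_graph n \<and> n \<ge> 3"
    then have ne: "G \<noteq> path_graph n" using path_graph_neq_cycle_graph by metis
    interpret path_or_cycle G n "int n" using G path_or_cycle_cycle_graph by simp
    show ?thesis
    proof (cases "n \<le> 2 * k + 2")
      case True
      \<comment> \<open>Hence \<open>r = n\<close>, which is not 1, and clause (iii) fails by its
        lower bound on \<open>n\<close>.\<close>
      then have "q = 0" by (simp add: q_def)
      then have "r \<noteq> 1" using n \<open>n \<ge> 2\<close> by simp
      then show ?thesis
        using True G ne assms(1) short_cycle_values[of k] unfolding one by auto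
    next
      case False
      \<comment> \<open>Here \<open>q = 0\<close> would give \<open>n = k + 2\<close>, too short, so
        \<open>n\<close> is at least \<open>4 * k + 4\<close>.\<close>
      have "n \<ge> 3 * k + 4" if "r = k + 2"
        using False n that assms(1) by (cases q) auto
      then show ?thesis
        using False G ne assms(1) distance_dimension_value[OF n r \<open>n \<ge> 2\<close>]
          distance_location_domination_number_value[OF n r]
        unfolding one k2 by auto
    qed
  qed
qed

end
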